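(* Let $X$ be a compactum. If $X$ is proximal, then its countable uniform power $\prod_u^{\omega} X$ is proximal.
   Context: All spaces are uniformizable, i.e. Tychonoff (completely regular Hausdorff); a compactum is a compact (Hausdorff) space. Entourages of a uniformity are taken to be symmetric, and $U[x]=\{y:\langle x,y\rangle\in U\}$ for an entourage $U$. A uniformity on a space is compatible if it induces the given topology. Countable uniform power: for a uniform space $\langle X,\mathfrak{U}\rangle$ and $U\in\mathfrak{U}$ let $\widetilde U=\{\langle f,g\rangle: f,g\in {}^{\omega}X,\ \forall n<\omega\ \langle f(n),g(n)\rangle\in U\}$. The sets $\widetilde U$, $U\in\mathfrak{U}$, form a base of a uniformity $\widetilde{\mathfrak{U}}$ on ${}^{\omega}X$, and $\prod_u^{\omega}\langle X,\mathfrak{U}\rangle$ is the set ${}^{\omega}X$ with the topology generated by $\widetilde{\mathfrak{U}}$. If $X$ has a unique compatible uniformity (e.g. if $X$ is compact) one writes $\prod_u^{\omega}X$. Proximal game on a uniform space $\langle X,\mathfrak{U}\rangle$: in inning $0$, player 1 chooses an entourage $U_0$ and then player 2 chooses $x_0\in X$. In inning $n+1$, player 1 chooses an entourage $U_{n+1}\subset U_n$ and then player 2 chooses $x_{n+1}\in U_n[x_n]$. Player 1 wins if either $\bigcap\{U_n[x_n]:n<\omega\}=\emptyset$ or the sequence $\{x_n:n<\omega\}$ converges in $X$; otherwise player 2 wins. Players know all previous moves. A topological space is proximal if it has a compatible uniformity for which player 1 has a winning strategy in the proximal game. *)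

theory Defs
  imports "HOL-Analysis.Analysis"
begin

section \<open>Uniformities on a set\<close>

text \<open>
  The class \<open>uniform_space\<close> provides one fixed uniformity per type. Proximality quantifies over
  the uniformities compatible with a given topology, so uniformities are treated here as families
  of subsets of \<open>S \<times> S\<close>. A uniformity is the full filter; the convention that entourages are
  symmetric is imposed where entourages are chosen, in the game below.
\<close>

definition is_uniformity :: "'a set \<Rightarrow> ('a \<times> 'a) set set \<Rightarrow> bool" where
  "is_uniformity S \<UU> \<longleftrightarrow>
     \<UU> \<noteq> {} \<and>
     (\<forall>U\<in>\<UU>. Id_on S \<subseteq> U \<and> U \<subseteq> S \<times> S) \<and>
     (\<forall>U\<in>\<UU>. converse U \<in> \<UU>) \<and>
     (\<forall>U\<in>\<UU>. \<forall>V\<in>\<UU>. U \<inter> V \<in> \<UU>) \<and>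
     (\<forall>U\<in>\<UU>. \<exists>V\<in>\<UU>. V O V \<subseteq> U) \<and>
     (\<forall>U\<in>\<UU>. \<forall>V. U \<subseteq> V \<and> V \<subseteq> S \<times> S \<longrightarrow> V \<in> \<UU>)"

text \<open>The section \<open>U[x] = {y. (x, y) \<in> U}\<close> is the image \<open>U `` {x}\<close>.\<close>

definition uniform_topology :: "'a set \<Rightarrow> ('a \<times> 'a) set set \<Rightarrow> 'a topology" where
  "uniform_topology S \<UU> =
     topology (\<lambda>A. A \<subseteq> S \<and> (\<forall>x\<in>A. \<exists>U\<in>\<UU>. U `` {x} \<subseteq> A))"

definition compatible_uniformity :: "'a topology \<Rightarrow> ('a \<times> 'a) set set \<Rightarrow> bool" where
  "compatible_uniformity X \<UU> \<longleftrightarrow>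
     is_uniformity (topspace X) \<UU> \<and> uniform_topology (topspace X) \<UU> = X"


section \<open>Countable uniform powers\<close>

definition power_entourage :: "('a \<times> 'a) set \<Rightarrow> ((nat \<Rightarrow> 'a) \<times> (nat \<Rightarrow> 'a)) set" where
  "power_entourage U = {(f, g). \<forall>n. (f n, g n) \<in> U}"

definition power_uniformity ::
  "'a set \<Rightarrow> ('a \<times> 'a) set set \<Rightarrow> ((nat \<Rightarrow> 'a) \<times> (nat \<Rightarrow> 'a)) set set" where
  "power_uniformity S \<UU> =
     {V. V \<subseteq> (UNIV \<rightarrow> S) \<times> (UNIV \<rightarrow> S) \<and> (\<exists>U\<in>\<UU>. power_entourage U \<subseteq> V)}"

definition uniform_power_wrt :: "'a set \<Rightarrow> ('a \<times> 'a) set set \<Rightarrow> (nat \<Rightarrow> 'a) topology" where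
  "uniform_power_wrt S \<UU> = uniform_topology (UNIV \<rightarrow> S) (power_uniformity S \<UU>)"

text \<open>
  Meaningful only when \<open>X\<close> has exactly one compatible uniformity. For compact \<open>X\<close> uniqueness is
  proved in \<open>compatible_uniformity_unique\<close>.
\<close>

definition uniform_power :: "'a topology \<Rightarrow> (nat \<Rightarrow> 'a) topology" where
  "uniform_power X = uniform_power_wrt (topspace X) (THE \<UU>. compatible_uniformity X \<UU>)"


section \<open>The proximal game\<close>

text \<open>
  A play is given by the sequences \<open>U\<close> and \<open>x\<close> of the moves of players 1 and 2. A strategy for
  player 1 maps the finite list of all previous moves of both players to the next move.
\<close>

type_synonym 'a strategy = "(('a \<times> 'a) set \<times> 'a) list \<Rightarrow> ('a \<times> 'a) set"

definition history ::
  "(nat \<Rightarrow> ('a \<times> 'a) set) \<Rightarrow> (nat \<Rightarrow> 'a) \<Rightarrow> nat \<Rightarrow> (('a \<times> 'a) set \<times> 'a) list" where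
  "history U x n = map (\<lambda>i. (U i, x i)) [0..<n]"

definition legal_move_1 ::
  "('a \<times> 'a) set set \<Rightarrow> (nat \<Rightarrow> ('a \<times> 'a) set) \<Rightarrow> nat \<Rightarrow> bool" where
  "legal_move_1 \<UU> U n \<longleftrightarrow>
     U n \<in> \<UU> \<and> sym (U n) \<and> (case n of 0 \<Rightarrow> True | Suc m \<Rightarrow> U (Suc m) \<subseteq> U m)"

definition legal_move_2 ::
  "'a set \<Rightarrow> (nat \<Rightarrow> ('a \<times> 'a) set) \<Rightarrow> (nat \<Rightarrow> 'a) \<Rightarrow> nat \<Rightarrow> bool" where
  "legal_move_2 S U x n \<longleftrightarrow>
     (case n of 0 \<Rightarrow> x 0 \<in> S | Suc m \<Rightarrow> x (Suc m) \<in> U m `` {x m})"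

definition player_1_wins ::
  "'a topology \<Rightarrow> (nat \<Rightarrow> ('a \<times> 'a) set) \<Rightarrow> (nat \<Rightarrow> 'a) \<Rightarrow> bool" where
  "player_1_wins X U x \<longleftrightarrow>
     (\<Inter>n. U n `` {x n}) = {} \<or> (\<exists>l. limitin X x l sequentially)"

text \<open>
  The first conjunct says that the strategy answers every position in which player 2 has moved
  legally so far by a legal move.
\<close>

definition winning_strategy ::
  "'a topology \<Rightarrow> ('a \<times> 'a) set set \<Rightarrow> 'a strategy \<Rightarrow> bool" where
  "winning_strategy X \<UU> \<sigma> \<longleftrightarrow>
     (\<forall>U x. (\<forall>n. U n = \<sigma> (history U x n)) \<longrightarrow>
        (\<forall>n. (\<forall>i<n. legal_move_2 (topspace X) U x i) \<longrightarrow> legal_move_1 \<UU> U n) \<and>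
        ((\<forall>n. legal_move_2 (topspace X) U x n) \<longrightarrow> player_1_wins X U x))"

text \<open>
  Spaces are Tychonoff by convention. Complete regularity follows from the existence of a
  compatible uniformity, the Hausdorff property does not.
\<close>

definition proximal :: "'a topology \<Rightarrow> bool" where
  "proximal X \<longleftrightarrow>
     Hausdorff_space X \<and>
     (\<exists>\<UU>. compatible_uniformity X \<UU> \<and> (\<exists>\<sigma>. winning_strategy X \<UU> \<sigma>))"


section \<open>Well-definedness\<close>

lemma
  assumes "is_uniformity S \<UU>"
  shows is_uniformity_nonempty: "\<exists>U. U \<in> \<UU>"
    and is_uniformity_refl: "U \<in> \<UU> \<Longrightarrow> x \<in> S \<Longrightarrow> (x, x) \<in> U"
    and is_uniformity_subset: "U \<in> \<UU> \<Longrightarrow> U \<subseteq> S \<times> S"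
    and is_uniformity_converse: "U \<in> \<UU> \<Longrightarrow> converse U \<in> \<UU>"
    and is_uniformity_Int: "U \<in> \<UU> \<Longrightarrow> V \<in> \<UU> \<Longrightarrow> U \<inter> V \<in> \<UU>"
    and is_uniformity_relcomp: "U \<in> \<UU> \<Longrightarrow> \<exists>V\<in>\<UU>. V O V \<subseteq> U"
    and is_uniformity_mono: "U \<in> \<UU> \<Longrightarrow> U \<subseteq> V \<Longrightarrow> V \<subseteq> S \<times> S \<Longrightarrow> V \<in> \<UU>"
proof -
  note u = assms[unfolded is_uniformity_def]
  show "\<exists>U. U \<in> \<UU>"
    using u[THEN conjunct1] by blast
  have *: "\<forall>U\<in>\<UU>. Id_on S \<subseteq> U \<and> U \<subseteq> S \<times> S"
    using u by (elim conjE)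
  show "(x, x) \<in> U" if "U \<in> \<UU>" "x \<in> S"
    using bspec[OF * \<open>U \<in> \<UU>\<close>] that by blast
  show "U \<subseteq> S \<times> S" if "U \<in> \<UU>"
    using bspec[OF * that] by (elim conjE)
  show "converse U \<in> \<UU>" if "U \<in> \<UU>"
    using u that by (elim conjE) (rule bspec)
  have **: "\<forall>U\<in>\<UU>. \<forall>V\<in>\<UU>. U \<inter> V \<in> \<UU>"
    using u by (elim conjE)
  show "U \<inter> V \<in> \<UU>" if "U \<in> \<UU>" "V \<in> \<UU>"
    by (rule bspec[OF bspec[OF ** that(1)] that(2)])
  have ***: "\<forall>U\<in>\<UU>. \<exists>V\<in>\<UU>. V O V \<subseteq> U"
    using u by (elim conjE)
  show "\<exists>V\<in>\<UU>. V O V \<subseteq> U" if "U \<in> \<UU>"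
    by (rule bspec[OF *** that])
  have ****: "\<forall>U\<in>\<UU>. \<forall>V. U \<subseteq> V \<and> V \<subseteq> S \<times> S \<longrightarrow> V \<in> \<UU>"
    using u by (elim conjE)
  show "V \<in> \<UU>" if "U \<in> \<UU>" "U \<subseteq> V" "V \<subseteq> S \<times> S"
    using bspec[OF **** that(1), THEN spec, of V] that(2,3) by blast
qed

lemma istopology_uniform:
  assumes uni: "is_uniformity S \<UU>"
  shows "istopology (\<lambda>A. A \<subseteq> S \<and> (\<forall>x\<in>A. \<exists>U\<in>\<UU>. U `` {x} \<subseteq> A))"
  unfolding istopology_def
proof (rule conjI; intro allI impI conjI ballI)
  fix A B x
  assume A: "A \<subseteq> S \<and> (\<forall>x\<in>A. \<exists>U\<in>\<UU>. U `` {x} \<subseteq> A)"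
    and B: "B \<subseteq> S \<and> (\<forall>x\<in>B. \<exists>U\<in>\<UU>. U `` {x} \<subseteq> B)"
  show "A \<inter> B \<subseteq> S"
    using A by blast
  assume "x \<in> A \<inter> B"
  then obtain U V where UV: "U \<in> \<UU>" "U `` {x} \<subseteq> A" "V \<in> \<UU>" "V `` {x} \<subseteq> B"
    using A B by (meson IntD1 IntD2)
  show "\<exists>W\<in>\<UU>. W `` {x} \<subseteq> A \<inter> B"
  proof
    show "U \<inter> V \<in> \<UU>"
      using UV is_uniformity_Int[OF uni] by simp
    show "(U \<inter> V) `` {x} \<subseteq> A \<inter> B"
      using UV by auto
  qed
next
  fix \<K> x
  assume \<K>: "\<forall>K\<in>\<K>. K \<subseteq> S \<and> (\<forall>x\<in>K. \<exists>U\<in>\<UU>. U `` {x} \<subseteq> K)"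
  show "\<Union>\<K> \<subseteq> S"
    using \<K> by (meson Sup_least)
  assume "x \<in> \<Union>\<K>"
  then obtain K where K: "K \<in> \<K>" "x \<in> K"
    by (rule UnionE)
  with \<K> obtain U where "U \<in> \<UU>" "U `` {x} \<subseteq> K"
    by meson
  then show "\<exists>U\<in>\<UU>. U `` {x} \<subseteq> \<Union>\<K>"
    using K by (meson Union_upper subset_trans)
qed

lemma openin_uniform_topology:
  assumes "is_uniformity S \<UU>"
  shows "openin (uniform_topology S \<UU>) A \<longleftrightarrow> A \<subseteq> S \<and> (\<forall>x\<in>A. \<exists>U\<in>\<UU>. U `` {x} \<subseteq> A)"
  unfolding uniform_topology_def topology_inverse'[OF istopology_uniform[OF assms]] ..

lemma topspace_uniform_topology:
  assumes "is_uniformity S \<UU>"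
  shows "topspace (uniform_topology S \<UU>) = S"
proof -
  have "openin (uniform_topology S \<UU>) S"
    using is_uniformity_nonempty[OF assms] is_uniformity_subset[OF assms]
    unfolding openin_uniform_topology[OF assms] by blast
  then show ?thesis
    using openin_uniform_topology[OF assms] openin_subset openin_topspace
    by (metis subset_antisym)
qed

lemma power_entourage_subset:
  assumes "U \<subseteq> S \<times> S"
  shows "power_entourage U \<subseteq> (UNIV \<rightarrow> S) \<times> (UNIV \<rightarrow> S)"
  using assms unfolding power_entourage_def by fastforce

lemma power_uniformityI:
  assumes "U \<in> \<UU>" "power_entourage U \<subseteq> V" "V \<subseteq> (UNIV \<rightarrow> S) \<times> (UNIV \<rightarrow> S)"
  shows "V \<in> power_uniformity S \<UU>"
  using assms unfolding power_uniformity_def by (intro CollectI conjI bexI)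

lemma power_uniformityE:
  assumes "V \<in> power_uniformity S \<UU>"
  obtains U where "U \<in> \<UU>" "power_entourage U \<subseteq> V" "V \<subseteq> (UNIV \<rightarrow> S) \<times> (UNIV \<rightarrow> S)"
  using assms unfolding power_uniformity_def by (elim CollectE conjE bexE) (rule that)

lemma is_uniformity_power:
  assumes uni: "is_uniformity S \<UU>"
  shows "is_uniformity (UNIV \<rightarrow> S) (power_uniformity S \<UU>)"
  unfolding is_uniformity_def
proof (intro conjI ballI allI impI)
  let ?P = "UNIV \<rightarrow> S :: (nat \<Rightarrow> 'a) set"
  have in_power: "power_entourage U \<in> power_uniformity S \<UU>" if "U \<in> \<UU>" for U
    using that power_entourage_subset[OF is_uniformity_subset[OF uni that]]
    by (intro power_uniformityI[of U]) simp_all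
  then show "power_uniformity S \<UU> \<noteq> {}"
    using is_uniformity_nonempty[OF uni] by (metis empty_iff)
  fix V assume "V \<in> power_uniformity S \<UU>"
  then obtain U where U: "U \<in> \<UU>" "power_entourage U \<subseteq> V" and V: "V \<subseteq> ?P \<times> ?P"
    by (rule power_uniformityE)
  show "V \<subseteq> ?P \<times> ?P"
    by (rule V)
  show "Id_on ?P \<subseteq> V"
  proof
    fix p assume "p \<in> Id_on ?P"
    then obtain f where f: "f \<in> ?P" "p = (f, f)"
      by (rule Id_onE)
    then have "\<forall>n. (f n, f n) \<in> U"
      using is_uniformity_refl[OF uni U(1)] by (simp add: Pi_iff)
    then show "p \<in> V"
      using U(2) f(2) unfolding power_entourage_def by auto
  qed
  show "converse V \<in> power_uniformity S \<UU>"
  proof (rule power_uniformityI)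
    show "converse U \<in> \<UU>"
      by (rule is_uniformity_converse[OF uni U(1)])
    show "power_entourage (converse U) \<subseteq> converse V"
      using U(2) unfolding power_entourage_def by auto
    show "converse V \<subseteq> ?P \<times> ?P"
      using converse_mono[THEN iffD2, OF V] unfolding converse_Times .
  qed
  show "\<exists>W\<in>power_uniformity S \<UU>. W O W \<subseteq> V"
  proof -
    obtain W where W: "W \<in> \<UU>" "W O W \<subseteq> U"
      using is_uniformity_relcomp[OF uni U(1)] by (elim bexE)
    have "power_entourage W O power_entourage W \<subseteq> power_entourage (W O W)"
      unfolding power_entourage_def by auto
    also have "\<dots> \<subseteq> power_entourage U"
      using W(2) unfolding power_entourage_def by auto
    also note U(2)
    finally show ?thesis
      using in_power[OF W(1)] by (intro bexI)
  qed
  fix V'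
  show "V' \<in> power_uniformity S \<UU>" if "V \<subseteq> V' \<and> V' \<subseteq> ?P \<times> ?P"
    using that by (intro power_uniformityI[OF U(1)] subset_trans[OF U(2)]) (elim conjE, assumption)+
  assume "V' \<in> power_uniformity S \<UU>"
  then obtain U' where U': "U' \<in> \<UU>" "power_entourage U' \<subseteq> V'"
    by (rule power_uniformityE)
  show "V \<inter> V' \<in> power_uniformity S \<UU>"
  proof (rule power_uniformityI)
    show "U \<inter> U' \<in> \<UU>"
      by (rule is_uniformity_Int[OF uni U(1) U'(1)])
    show "power_entourage (U \<inter> U') \<subseteq> V \<inter> V'"
      using U(2) U'(2) unfolding power_entourage_def by auto
    show "V \<inter> V' \<subseteq> ?P \<times> ?P"
      using V by (rule le_infI1)
  qed
qed

lemma compatible_uniformity_power: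
  assumes "is_uniformity S \<UU>"
  shows "compatible_uniformity (uniform_power_wrt S \<UU>) (power_uniformity S \<UU>)"
  using is_uniformity_power[OF assms]
  unfolding compatible_uniformity_def uniform_power_wrt_def
  by (simp add: topspace_uniform_topology)

lemma uniform_topology_nhd:
  assumes uni: "is_uniformity S \<UU>" and U: "U \<in> \<UU>" and x: "x \<in> S"
  shows "\<exists>A. openin (uniform_topology S \<UU>) A \<and> x \<in> A \<and> A \<subseteq> U `` {x}"
proof -
  define A where "A = {y \<in> S. \<exists>V\<in>\<UU>. V `` {y} \<subseteq> U `` {x}}"
  have "\<exists>W\<in>\<UU>. W `` {y} \<subseteq> A" if "y \<in> A" for y
  proof -
    obtain V where V: "V \<in> \<UU>" "V `` {y} \<subseteq> U `` {x}"
      using \<open>y \<in> A\<close> unfolding A_def by blast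
    obtain W where W: "W \<in> \<UU>" "W O W \<subseteq> V"
      using is_uniformity_relcomp[OF uni] V by blast
    have "W `` {z} \<subseteq> U `` {x}" if "z \<in> W `` {y}" for z
      using W V that by blast
    moreover have "W `` {y} \<subseteq> S"
      using is_uniformity_subset[OF uni] W by blast
    ultimately have "W `` {y} \<subseteq> A"
      using W(1) unfolding A_def by blast
    with W show ?thesis
      by blast
  qed
  moreover have "A \<subseteq> S"
    unfolding A_def by blast
  ultimately have "openin (uniform_topology S \<UU>) A"
    unfolding openin_uniform_topology[OF uni] by blast
  moreover have "x \<in> A"
    using U x unfolding A_def by blast
  moreover have "A \<subseteq> U `` {x}"
  proof
    fix y assume "y \<in> A"
    then obtain V where "y \<in> S" "V \<in> \<UU>" "V `` {y} \<subseteq> U `` {x}"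
      unfolding A_def by blast
    moreover have "(y, y) \<in> V"
      using is_uniformity_refl[OF uni] \<open>y \<in> S\<close> \<open>V \<in> \<UU>\<close> by blast
    ultimately show "y \<in> U `` {x}"
      by blast
  qed
  ultimately show ?thesis
    by blast
qed

lemma is_uniformity_Inter:
  assumes uni: "is_uniformity S \<UU>" and "finite I" "I \<noteq> {}" "\<And>i. i \<in> I \<Longrightarrow> V i \<in> \<UU>"
  shows "(\<Inter>i\<in>I. V i) \<in> \<UU>"
  using assms(2-4)
proof (induction I rule: finite_ne_induct)
  case (insert i F)
  then show ?case
    using is_uniformity_Int[OF uni] by simp
qed simp

lemma compatible_uniformity_subset:
  assumes comp: "compact_space X"
    and U: "compatible_uniformity X \<UU>" and V: "compatible_uniformity X \<VV>"
  shows "\<UU> \<subseteq> \<VV>"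
proof
  let ?S = "topspace X"
  have uU: "is_uniformity ?S \<UU>" "uniform_topology ?S \<UU> = X"
    and uV: "is_uniformity ?S \<VV>" "uniform_topology ?S \<VV> = X"
    using U V unfolding compatible_uniformity_def by auto
  fix U assume "U \<in> \<UU>"
  then have US: "U \<subseteq> ?S \<times> ?S"
    using is_uniformity_subset[OF uU(1)] by blast
  obtain W0 where W0: "W0 \<in> \<UU>" "W0 O W0 \<subseteq> U"
    using is_uniformity_relcomp[OF uU(1)] \<open>U \<in> \<UU>\<close> by blast
  define W where "W = W0 \<inter> converse W0"
  have "W \<in> \<UU>"
    unfolding W_def using is_uniformity_Int[OF uU(1)] is_uniformity_converse[OF uU(1)] W0 by blast
  moreover have "converse W = W" "W O W \<subseteq> U"
    using W0 unfolding W_def by blast+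
  ultimately have W: "W \<in> \<UU>" "converse W = W" "W O W \<subseteq> U"
    by blast+
  have "\<exists>V A. V \<in> \<VV> \<and> openin X A \<and> x \<in> A \<and> A \<subseteq> V `` {x} \<and> (V O V) `` {x} \<subseteq> W `` {x}"
    if x: "x \<in> ?S" for x
  proof -
    obtain B where B: "openin X B" "x \<in> B" "B \<subseteq> W `` {x}"
      using uniform_topology_nhd[OF uU(1) W(1) x] uU(2) by auto
    then obtain V' where V': "V' \<in> \<VV>" "V' `` {x} \<subseteq> B"
      using openin_uniform_topology[OF uV(1)] uV(2) by auto
    then obtain V where V: "V \<in> \<VV>" "V O V \<subseteq> V'"
      using is_uniformity_relcomp[OF uV(1)] by blast
    obtain A where "openin X A" "x \<in> A" "A \<subseteq> V `` {x}"
      using uniform_topology_nhd[OF uV(1) V(1) x] uV(2) by auto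
    moreover have "(V O V) `` {x} \<subseteq> W `` {x}"
      using V V' B by blast
    ultimately show ?thesis
      using V by blast
  qed
  then obtain V A where VA: "\<And>x. x \<in> ?S \<Longrightarrow>
      V x \<in> \<VV> \<and> openin X (A x) \<and> x \<in> A x \<and> A x \<subseteq> V x `` {x} \<and> (V x O V x) `` {x} \<subseteq> W `` {x}"
    by metis
  show "U \<in> \<VV>"
  proof (cases "?S = {}")
    case True
    then have "U = {}"
      using US by blast
    moreover obtain V0 where "V0 \<in> \<VV>"
      using is_uniformity_nonempty[OF uV(1)] by blast
    moreover have "V0 = {}"
      using is_uniformity_subset[OF uV(1) \<open>V0 \<in> \<VV>\<close>] True by blast
    ultimately show ?thesis
      by simp
  next
    case False
    have "compactin X ?S"
      using comp unfolding compact_space_def .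
    moreover have "\<forall>B\<in>A ` ?S. openin X B" "?S \<subseteq> \<Union>(A ` ?S)"
      using VA by blast+
    ultimately obtain \<F> where "finite \<F>" "\<F> \<subseteq> A ` ?S" "?S \<subseteq> \<Union>\<F>"
      unfolding compactin_def by meson
    then obtain I where I: "finite I" "I \<subseteq> ?S" "?S \<subseteq> (\<Union>i\<in>I. A i)"
      by (metis finite_subset_image)
    define V0 where "V0 = (\<Inter>i\<in>I. V i)"
    have "V0 \<in> \<VV>"
      unfolding V0_def using I VA False by (intro is_uniformity_Inter[OF uV(1)]) auto
    moreover have "V0 \<subseteq> U"
    proof (rule subrelI)
      fix y z assume yz: "(y, z) \<in> V0"
      have "y \<in> ?S"
        using is_uniformity_subset[OF uV(1) \<open>V0 \<in> \<VV>\<close>] yz by blast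
      then obtain i where i: "i \<in> I" "y \<in> A i"
        using I by blast
      then have "i \<in> ?S" "(i, y) \<in> V i" "(y, z) \<in> V i"
        using I VA yz unfolding V0_def by blast+
      moreover have "(y, y) \<in> V i"
        using is_uniformity_refl[OF uV(1)] VA[OF \<open>i \<in> ?S\<close>] \<open>y \<in> ?S\<close> by blast
      ultimately have "(i, y) \<in> W" "(i, z) \<in> W"
        using VA[OF \<open>i \<in> ?S\<close>] by blast+
      then show "(y, z) \<in> U"
        using W by blast
    qed
    ultimately show ?thesis
      using is_uniformity_mono[OF uV(1)] US by blast
  qed
qed

lemma compatible_uniformity_unique:
  assumes "compact_space X" "compatible_uniformity X \<UU>" "compatible_uniformity X \<VV>"
  shows "\<UU> = \<VV>"
  by (intro subset_antisym compatible_uniformity_subset[OF assms(1)] assms(2,3))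

lemma uniform_power_eq:
  assumes "compact_space X" "compatible_uniformity X \<UU>"
  shows "uniform_power X = uniform_power_wrt (topspace X) \<UU>"
proof -
  have "(THE \<UU>. compatible_uniformity X \<UU>) = \<UU>"
    by (rule the_equality) (use assms compatible_uniformity_unique[OF assms(1)] in simp_all)
  then show ?thesis
    unfolding uniform_power_def by simp
qed

end

theory Submission
  imports Defs
begin

text \<open>
  Fix a winning strategy \<open>\<sigma>\<close> of player 1 on the compactum \<open>X\<close>. The heart of the matter is that
  the answers of \<open>\<sigma>\<close> to plays with points in a set \<open>C\<close> determine the uniformity on the closure
  of \<open>C\<close> (lemma \<open>answers_separate_closure\<close>): suppose that \<open>a\<close> and \<open>b\<close> lie in the closure of \<open>C\<close>
  and are identified by all these answers, after each has been shrunk to a symmetric \<open>W\<close> with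
  \<open>W O W O W\<close> inside it. Then player 2 may choose \<open>x\<^sub>n \<in> C\<close> alternately near \<open>a\<close> and near \<open>b\<close>:
  since \<open>U\<^sub>n\<close> is already known when \<open>x\<^sub>n\<close> is chosen, these moves are legal, and all \<open>U\<^sub>n[x\<^sub>n]\<close>
  contain \<open>a\<close>. As \<open>\<sigma>\<close> wins, \<open>x\<^sub>n\<close> converges, so \<open>(a, b)\<close> lies in every entourage.

  In the uniform power player 2 chooses \<open>f\<^sub>0, f\<^sub>1, \<dots>\<close>, and the set \<open>C\<close> of all values \<open>f\<^sub>n k\<close> is
  countable. Hence there are only countably many finite plays with points in \<open>C\<close>, and player 1
  can arrange, treating finitely many of them in each inning, that the entourages \<open>W\<^sub>n\<close> played
  (one \<open>W\<^sub>n\<close> for all coordinates) finally refine all shrunk answers. Making also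
  \<open>W\<^sub>n\<^sub>+\<^sub>1 O W\<^sub>n\<^sub>+\<^sub>1 O W\<^sub>n\<^sub>+\<^sub>1 \<subseteq> W\<^sub>n\<close> one gets, for cluster points \<open>g k\<close> of \<open>f\<^sub>n k\<close>, that
  \<open>f\<^sub>n k\<close> and \<open>g k\<close> are \<open>W\<^sub>m\<close>-close for all large \<open>n\<close> and all \<open>k\<close>. If the convergence to \<open>g\<close> were
  not uniform, compactness would yield a cluster point \<open>(a, b)\<close> of pairs \<open>(f\<^sub>n k, g k)\<close> outside a
  fixed entourage. It lies in all \<open>W\<^sub>m\<close>, which contradicts the separation lemma.
\<close>

section \<open>Cube roots of entourages\<close>

text \<open>A chosen symmetric entourage whose threefold composition lies in \<open>U\<close>.\<close>

definition cube_root :: "('a \<times> 'a) set set \<Rightarrow> ('a \<times> 'a) set \<Rightarrow> ('a \<times> 'a) set" where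
  "cube_root \<UU> U = (SOME W. W \<in> \<UU> \<and> sym W \<and> W O W O W \<subseteq> U)"

lemma is_uniformity_Times:
  assumes "is_uniformity S \<UU>"
  shows "S \<times> S \<in> \<UU>"
  using is_uniformity_nonempty[OF assms] is_uniformity_subset[OF assms]
    is_uniformity_mono[OF assms] by blast

lemma cube_root:
  assumes uni: "is_uniformity S \<UU>" and U: "U \<in> \<UU>"
  shows cube_root_in: "cube_root \<UU> U \<in> \<UU>"
    and sym_cube_root: "sym (cube_root \<UU> U)"
    and cube_root_trans3:
      "(x, y) \<in> cube_root \<UU> U \<Longrightarrow> (y, z) \<in> cube_root \<UU> U \<Longrightarrow> (z, w) \<in> cube_root \<UU> U
        \<Longrightarrow> (x, w) \<in> U"
    and cube_root_trans:
      "(x, y) \<in> cube_root \<UU> U \<Longrightarrow> (y, z) \<in> cube_root \<UU> U \<Longrightarrow> (x, z) \<in> U"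
    and cube_root_subset: "cube_root \<UU> U \<subseteq> U"
proof -
  obtain V where V: "V \<in> \<UU>" "V O V \<subseteq> U"
    using is_uniformity_relcomp[OF uni U] by blast
  obtain W where W: "W \<in> \<UU>" "W O W \<subseteq> V"
    using is_uniformity_relcomp[OF uni V(1)] by blast
  have WV: "W \<subseteq> V"
    using W is_uniformity_subset[OF uni W(1)] is_uniformity_refl[OF uni W(1)] by fast
  let ?W = "W \<inter> converse W"
  have "?W \<in> \<UU>"
    using is_uniformity_Int[OF uni W(1) is_uniformity_converse[OF uni W(1)]] .
  moreover have "sym ?W"
    by (auto simp: sym_def)
  moreover have "?W O ?W O ?W \<subseteq> U"
  proof -
    have "?W O ?W O ?W \<subseteq> W O W O W"
      by (intro relcomp_mono) blast+
    also have "\<dots> \<subseteq> V O V"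
      by (rule relcomp_mono[OF WV W(2)])
    finally show ?thesis
      using V(2) by (rule subset_trans)
  qed
  ultimately have "\<exists>W. W \<in> \<UU> \<and> sym W \<and> W O W O W \<subseteq> U"
    by blast
  then have *: "cube_root \<UU> U \<in> \<UU> \<and> sym (cube_root \<UU> U)
      \<and> cube_root \<UU> U O cube_root \<UU> U O cube_root \<UU> U \<subseteq> U"
    unfolding cube_root_def by (rule someI_ex)
  then show in_U: "cube_root \<UU> U \<in> \<UU>" and "sym (cube_root \<UU> U)"
    by blast+
  show trans3: "(x, w) \<in> U"
    if "(x, y) \<in> cube_root \<UU> U" "(y, z) \<in> cube_root \<UU> U" "(z, w) \<in> cube_root \<UU> U" for x y z w
    using * that by blast
  have refl: "(y, y) \<in> cube_root \<UU> U" if "y \<in> S" for y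
    using is_uniformity_refl[OF uni in_U that] .
  have sub: "cube_root \<UU> U \<subseteq> S \<times> S"
    using is_uniformity_subset[OF uni in_U] .
  show trans: "(x, z) \<in> U" if "(x, y) \<in> cube_root \<UU> U" "(y, z) \<in> cube_root \<UU> U" for x y z
    using trans3[OF that refl] sub that by blast
  show "cube_root \<UU> U \<subseteq> U"
    using trans[OF _ refl] sub by fast
qed

section \<open>Cluster points\<close>

lemma compact_space_cluster_point:
  assumes comp: "compact_space X" and inf: "infinite J"
    and p: "\<And>j. j \<in> J \<Longrightarrow> p j \<in> topspace X"
  obtains a where "a \<in> topspace X"
    and "\<And>A. openin X A \<Longrightarrow> a \<in> A \<Longrightarrow> infinite {j \<in> J. p j \<in> A}"
proof (rule ccontr)
  assume "\<not> thesis"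
  with that have "\<forall>a\<in>topspace X. \<exists>A. openin X A \<and> a \<in> A \<and> finite {j \<in> J. p j \<in> A}"
    by blast
  then obtain A where A:
    "\<And>a. a \<in> topspace X \<Longrightarrow> openin X (A a) \<and> a \<in> A a \<and> finite {j \<in> J. p j \<in> A a}"
    by metis
  have "compactin X (topspace X)"
    using comp unfolding compact_space_def .
  moreover have "\<forall>B\<in>A ` topspace X. openin X B" "topspace X \<subseteq> \<Union>(A ` topspace X)"
    using A by blast+
  ultimately obtain \<F> where "finite \<F>" "\<F> \<subseteq> A ` topspace X" "topspace X \<subseteq> \<Union>\<F>"
    unfolding compactin_def by meson
  then obtain I where I: "finite I" "I \<subseteq> topspace X" "topspace X \<subseteq> (\<Union>i\<in>I. A i)"
    by (metis finite_subset_image)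
  have "J \<subseteq> (\<Union>i\<in>I. {j \<in> J. p j \<in> A i})"
    using I(3) p by blast
  moreover have "finite (\<Union>i\<in>I. {j \<in> J. p j \<in> A i})"
    using I A by blast
  ultimately show False
    using inf finite_subset by blast
qed

lemma compatible_uniformity_nhd:
  assumes "compatible_uniformity X \<UU>" "U \<in> \<UU>" "x \<in> topspace X"
  obtains A where "openin X A" "x \<in> A" "A \<subseteq> U `` {x}"
  using assms uniform_topology_nhd[of "topspace X" \<UU> U x]
  unfolding compatible_uniformity_def by metis

lemma compatible_uniformity_cluster_pair:
  assumes comp: "compact_space X" and cu: "compatible_uniformity X \<UU>" and inf: "infinite J"
    and pq: "\<And>j. j \<in> J \<Longrightarrow> p j \<in> topspace X" "\<And>j. j \<in> J \<Longrightarrow> q j \<in> topspace X"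
  shows "\<exists>a\<in>topspace X. \<exists>b\<in>topspace X.
    \<forall>U\<in>\<UU>. infinite {j \<in> J. (a, p j) \<in> U \<and> (b, q j) \<in> U}"
proof -
  have comp2: "compact_space (prod_topology X X)"
    using comp by (simp add: compact_space_prod_topology)
  have pq2: "(p j, q j) \<in> topspace (prod_topology X X)" if "j \<in> J" for j
    using pq that by simp
  obtain c where c: "c \<in> topspace (prod_topology X X)"
    "\<And>A. openin (prod_topology X X) A \<Longrightarrow> c \<in> A \<Longrightarrow> infinite {j \<in> J. (p j, q j) \<in> A}"
    using compact_space_cluster_point[where p = "\<lambda>j. (p j, q j)", OF comp2 inf pq2] by blast
  obtain a b where ab: "c = (a, b)" "a \<in> topspace X" "b \<in> topspace X"
    using c(1) by auto
  have "infinite {j \<in> J. (a, p j) \<in> U \<and> (b, q j) \<in> U}" if U: "U \<in> \<UU>" for U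
  proof -
    obtain A where A: "openin X A" "a \<in> A" "A \<subseteq> U `` {a}"
      using compatible_uniformity_nhd[OF cu U ab(2)] .
    obtain B where B: "openin X B" "b \<in> B" "B \<subseteq> U `` {b}"
      using compatible_uniformity_nhd[OF cu U ab(3)] .
    have "infinite {j \<in> J. (p j, q j) \<in> A \<times> B}"
      using A B ab(1) by (intro c(2)) (auto simp: openin_prod_Times_iff)
    moreover have "{j \<in> J. (p j, q j) \<in> A \<times> B} \<subseteq> {j \<in> J. (a, p j) \<in> U \<and> (b, q j) \<in> U}"
      using A B by blast
    ultimately show ?thesis
      using finite_subset by blast
  qed
  then show ?thesis
    using ab by blast
qed

section \<open>Answers of a strategy\<close>

text \<open>
  The position reached when player 1 follows \<open>\<sigma>\<close> and player 2 has chosen the points \<open>xs\<close>, and the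
  next move of player 1 there.
\<close>

definition position :: "'a strategy \<Rightarrow> 'a list \<Rightarrow> (('a \<times> 'a) set \<times> 'a) list" where
  "position \<sigma> xs = foldl (\<lambda>h y. h @ [(\<sigma> h, y)]) [] xs"

definition answer :: "'a strategy \<Rightarrow> 'a list \<Rightarrow> ('a \<times> 'a) set" where
  "answer \<sigma> xs = \<sigma> (position \<sigma> xs)"

lemma history_Suc: "history U x (Suc n) = history U x n @ [(U n, x n)]"
  unfolding history_def by simp

lemma history_eq_position:
  assumes "\<And>n. U n = \<sigma> (history U x n)"
  shows "history U x n = position \<sigma> (map x [0..<n])"
proof (induction n)
  case 0
  then show ?case
    by (simp add: history_def position_def)
next
  case (Suc n)
  then show ?case
    using assms[of n] by (simp add: history_Suc position_def)
qed

text \<open>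
  Closeness of \<open>a\<close> and \<open>b\<close> to \<open>C\<close> is stated by entourages: both lie in its closure. In the proof,
  \<open>c n\<close> is the target (\<open>a\<close> or \<open>b\<close>) that the \<open>n\<close>-th point of player 2 approximates.
\<close>

lemma answers_separate_closure:
  assumes cu: "compatible_uniformity X \<UU>" and win: "winning_strategy X \<UU> \<sigma>"
    and C: "C \<subseteq> topspace X" and ab: "a \<in> topspace X" "b \<in> topspace X"
    and cl: "\<And>U. U \<in> \<UU> \<Longrightarrow> \<exists>y\<in>C. (a, y) \<in> U" "\<And>U. U \<in> \<UU> \<Longrightarrow> \<exists>y\<in>C. (b, y) \<in> U"
    and answers: "\<And>xs. set xs \<subseteq> C \<Longrightarrow> answer \<sigma> xs \<in> \<UU> \<Longrightarrow> (a, b) \<in> cube_root \<UU> (answer \<sigma> xs)"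
    and V: "V \<in> \<UU>"
  shows "(a, b) \<in> V"
proof -
  have uni: "is_uniformity (topspace X) \<UU>"
    using cu unfolding compatible_uniformity_def by blast
  let ?r = "cube_root \<UU>"
  note cr = cube_root[OF uni]
  define V1 where "V1 = ?r (?r V)"
  have V1: "V1 \<in> \<UU>"
    unfolding V1_def using cr(1) V by blast
  define c where "c n = (if even n then a else b)" for n :: nat
  \<comment> \<open>Roots of all earlier entourages are respected, since \<open>cube_root\<close> need not be monotone.\<close>
  define good where "good h y \<longleftrightarrow> y \<in> C \<and> (c (length h), y) \<in> V1 \<and>
    (\<forall>U\<in>insert (\<sigma> h) (fst ` set h). (c (length h), y) \<in> ?r U)" for h y
  define H where "H = rec_nat [] (\<lambda>_ h. h @ [(\<sigma> h, SOME y. good h y)])"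
  have H_simps: "H 0 = []" "H (Suc n) = H n @ [(\<sigma> (H n), SOME y. good (H n) y)]" for n
    unfolding H_def by simp_all
  define U where "U n = \<sigma> (H n)" for n
  define x where "x n = (SOME y. good (H n) y)" for n
  have H_eq: "H n = history U x n" for n
    by (induction n) (simp_all add: H_simps U_def x_def history_Suc, simp add: history_def)
  have U_eq: "U n = \<sigma> (history U x n)" for n
    using H_eq U_def by simp
  have U_answer: "U n = answer \<sigma> (map x [0..<n])" for n
    unfolding answer_def using U_eq history_eq_position[of U \<sigma> x] by metis
  have legal_1: "legal_move_1 \<UU> U n" if "\<forall>i<n. legal_move_2 (topspace X) U x i" for n
    using win U_eq that unfolding winning_strategy_def by blast
  have length_H: "length (H n) = n" for n
    unfolding H_eq history_def by simp
  have "fst ` set (H n) = U ` {..<n}" for n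
    unfolding H_eq history_def by (simp add: image_image atLeast0LessThan)
  then have fst_H: "insert (\<sigma> (H n)) (fst ` set (H n)) = U ` {..n}" for n
    by (simp add: U_def flip: lessThan_Suc_atMost)
       (simp add: lessThan_Suc)
  have c_cl: "\<exists>y\<in>C. (c n, y) \<in> W" if "W \<in> \<UU>" for n W
    using cl that unfolding c_def by simp
  have c_root: "(c i, c j) \<in> ?r (U n)" if "U n \<in> \<UU>" "\<forall>i<n. x i \<in> C" for i j n
  proof -
    have "set (map x [0..<n]) \<subseteq> C"
      using that(2) by auto
    then have "(a, b) \<in> ?r (U n)"
      using answers that(1) unfolding U_answer by blast
    then show ?thesis
      using symD[OF cr(2)[OF that(1)]] is_uniformity_refl[OF uni cr(1)[OF that(1)]] ab
      unfolding c_def by auto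
  qed
  have main: "legal_move_2 (topspace X) U x n \<and> good (H n) (x n)" for n
  proof (induction n rule: less_induct)
    case (less n)
    have U_in: "U m \<in> \<UU>" if "m \<le> n" for m
      using legal_1[of m] less that unfolding legal_move_1_def by auto
    let ?I = "\<Inter>W\<in>insert V1 ((\<lambda>m. ?r (U m)) ` {..n}). W"
    have I: "?I \<in> \<UU>"
      using U_in V1 cr(1) by (intro is_uniformity_Inter[OF uni]) auto
    obtain y where y: "y \<in> C" "(c n, y) \<in> ?I"
      using c_cl[OF I, of n] by (elim bexE)
    have "good (H n) y"
      using y unfolding good_def fst_H length_H by auto
    then have good_n: "good (H n) (x n)"
      unfolding x_def by (rule someI)
    have near: "(c m, x m) \<in> ?r (U i)" "x m \<in> C" if "i \<le> m" "m \<le> n" for i m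
    proof -
      have "good (H m) (x m)"
        using less[of m] good_n that by (cases "m = n") auto
      then show "(c m, x m) \<in> ?r (U i)" "x m \<in> C"
        using that unfolding good_def fst_H length_H by auto
    qed
    have "legal_move_2 (topspace X) U x n"
    proof (cases n)
      case 0
      then show ?thesis
        using near(2)[of n n] C unfolding legal_move_2_def by auto
    next
      case (Suc m)
      have Um: "U m \<in> \<UU>"
        using U_in Suc by simp
      \<comment> \<open>The move is legal through the three steps from \<open>x m\<close> to \<open>c m\<close>, \<open>c n\<close> and \<open>x n\<close>.\<close>
      have "(x m, c m) \<in> ?r (U m)" "(c n, x n) \<in> ?r (U m)"
        using near(1)[of m m] near(1)[of m n] symD[OF cr(2)[OF Um]] Suc by auto
      moreover have "(c m, c n) \<in> ?r (U m)"
        using c_root[OF Um] near(2)[of 0] Suc by simp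
      ultimately have "(x m, x n) \<in> U m"
        using cr(3)[OF Um] by blast
      then show ?thesis
        using Suc unfolding legal_move_2_def by auto
    qed
    with good_n show ?case
      by blast
  qed
  have near: "(c n, x n) \<in> ?r (U n)" "(c n, x n) \<in> V1" "x n \<in> C" for n
    using main[of n] unfolding good_def fst_H length_H by auto
  have U_in: "U n \<in> \<UU>" for n
    using legal_1 main unfolding legal_move_1_def by blast
  have "(x n, a) \<in> U n" for n
  proof -
    have "(x n, c n) \<in> ?r (U n)"
      using near(1) symD[OF cr(2)[OF U_in]] by blast
    moreover have "(c n, c 0) \<in> ?r (U n)"
      using c_root U_in near(3) by blast
    ultimately show ?thesis
      using cr(4)[OF U_in] unfolding c_def by auto
  qed
  then have "(\<Inter>n. U n `` {x n}) \<noteq> {}"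
    by blast
  moreover have "player_1_wins X U x"
    using win U_eq main unfolding winning_strategy_def by blast
  ultimately obtain l where l: "limitin X x l sequentially"
    unfolding player_1_wins_def by blast
  then have l_mem: "l \<in> topspace X"
    by (rule limitin_topspace)
  obtain A where A: "openin X A" "l \<in> A" "A \<subseteq> V1 `` {l}"
    using compatible_uniformity_nhd[OF cu V1 l_mem] .
  obtain N where "\<forall>n\<ge>N. x n \<in> A"
    using l A(1,2) unfolding limitin_sequentially by metis
  then have N: "(l, x n) \<in> V1" if "n \<ge> N" for n
    using A(3) that by auto
  have rV: "?r V \<in> \<UU>"
    using cr(1) V .
  have V1_sym: "sym V1"
    unfolding V1_def using cr(2) rV .
  have l_near: "(l, c n) \<in> ?r V" if "n \<ge> N" for n
    using cr(4)[OF rV, folded V1_def, OF N[OF that] symD[OF V1_sym near(2)]] .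
  have "(l, a) \<in> ?r V" "(l, b) \<in> ?r V"
    using l_near[of "2 * N"] l_near[of "2 * N + 1"] unfolding c_def by auto
  then show ?thesis
    using cr(4)[OF V symD[OF cr(2)[OF V]]] by blast
qed

section \<open>The strategy in the uniform power\<close>

text \<open>The finitely many values of \<open>f\<^sub>0, \<dots>, f\<^sub>n\<close> at the coordinates up to \<open>n\<close>.\<close>

definition values_upto :: "(nat \<Rightarrow> nat \<Rightarrow> 'a) \<Rightarrow> nat \<Rightarrow> 'a set" where
  "values_upto f n = (\<lambda>(i, k). f i k) ` ({..n} \<times> {..n})"

text \<open>
  The entourage \<open>W\<^sub>n\<close> of \<open>X\<close> used by player 1 in inning \<open>n\<close> of the power game. It depends only on
  \<open>f\<^sub>0, \<dots>, f\<^sub>n\<^sub>-\<^sub>1\<close>. Lists that do not come from legal plays may be answered by sets outside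
  \<open>\<UU>\<close>, which are ignored.
\<close>

primrec power_answer ::
  "'a set \<Rightarrow> ('a \<times> 'a) set set \<Rightarrow> 'a strategy \<Rightarrow> (nat \<Rightarrow> nat \<Rightarrow> 'a) \<Rightarrow> nat \<Rightarrow> ('a \<times> 'a) set" where
  "power_answer S \<UU> \<sigma> f 0 = S \<times> S"
| "power_answer S \<UU> \<sigma> f (Suc n) = cube_root \<UU> (power_answer S \<UU> \<sigma> f n) \<inter>
     (\<Inter>U\<in>answer \<sigma> ` {xs. set xs \<subseteq> values_upto f n \<and> length xs \<le> n} \<inter> \<UU>. cube_root \<UU> U)"

definition power_strategy ::
  "'a set \<Rightarrow> ('a \<times> 'a) set set \<Rightarrow> 'a strategy \<Rightarrow> (nat \<Rightarrow> 'a) strategy" where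
  "power_strategy S \<UU> \<sigma> h =
     power_entourage (power_answer S \<UU> \<sigma> (\<lambda>i. snd (h ! i)) (length h))"

lemma finite_values_upto: "finite (values_upto f n)"
  unfolding values_upto_def by simp

lemma power_answer_cong:
  assumes "\<And>i. i < n \<Longrightarrow> f i = g i"
  shows "power_answer S \<UU> \<sigma> f n = power_answer S \<UU> \<sigma> g n"
  using assms
proof (induction n)
  case (Suc n)
  have "values_upto f n = values_upto g n"
    unfolding values_upto_def using Suc.prems by (intro image_cong) auto
  then show ?case
    using Suc by simp
qed simp

lemma power_strategy_history:
  "power_strategy S \<UU> \<sigma> (history U f n) = power_entourage (power_answer S \<UU> \<sigma> f n)"
  unfolding power_strategy_def history_def
  by (simp, intro arg_cong[where f = power_entourage] power_answer_cong) simp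

lemma power_answer_in:
  assumes uni: "is_uniformity S \<UU>"
  shows "power_answer S \<UU> \<sigma> f n \<in> \<UU> \<and> sym (power_answer S \<UU> \<sigma> f n)"
proof (induction n)
  case 0
  then show ?case
    using is_uniformity_Times[OF uni] by (simp add: sym_def)
next
  case (Suc n)
  let ?A = "answer \<sigma> ` {xs. set xs \<subseteq> values_upto f n \<and> length xs \<le> n} \<inter> \<UU>"
  let ?W = "power_answer S \<UU> \<sigma> f n"
  have "finite ?A"
    using finite_lists_length_le[OF finite_values_upto] by blast
  then have "(\<Inter>U\<in>insert ?W ?A. cube_root \<UU> U) \<in> \<UU>"
    using Suc cube_root_in[OF uni] by (intro is_uniformity_Inter[OF uni]) auto
  moreover have "sym (\<Inter>U\<in>insert ?W ?A. cube_root \<UU> U)"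
    using Suc sym_cube_root[OF uni] by (intro sym_INTER) auto
  ultimately show ?case
    by simp
qed

lemma power_answer_Suc_subset:
  "power_answer S \<UU> \<sigma> f (Suc n) \<subseteq> cube_root \<UU> (power_answer S \<UU> \<sigma> f n)"
  by simp

lemma power_answer_antimono:
  assumes "is_uniformity S \<UU>" "m \<le> n"
  shows "power_answer S \<UU> \<sigma> f n \<subseteq> power_answer S \<UU> \<sigma> f m"
proof (rule lift_Suc_antimono_le[OF _ assms(2)])
  show "power_answer S \<UU> \<sigma> f (Suc i) \<subseteq> power_answer S \<UU> \<sigma> f i" for i
    by (rule subset_trans[OF power_answer_Suc_subset
          cube_root_subset[OF assms(1) power_answer_in[OF assms(1), THEN conjunct1]]])
qed

lemma power_answer_refines_answers:
  assumes uni: "is_uniformity S \<UU>" and xs: "set xs \<subseteq> range (\<lambda>(i, k). f i k)"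
    and "answer \<sigma> xs \<in> \<UU>"
  obtains n where "power_answer S \<UU> \<sigma> f n \<subseteq> cube_root \<UU> (answer \<sigma> xs)"
proof -
  have "\<exists>n. set xs \<subseteq> values_upto f n \<and> length xs \<le> n"
    using xs
  proof (induction xs)
    case (Cons x xs)
    then obtain n i k where n: "set xs \<subseteq> values_upto f n" "length xs \<le> n" and x: "x = f i k"
      by auto
    let ?m = "max (Suc n) (max i k)"
    have "values_upto f n \<subseteq> values_upto f ?m" "x \<in> values_upto f ?m"
      unfolding values_upto_def x by (force simp: image_iff)+
    then have "set (x # xs) \<subseteq> values_upto f ?m \<and> length (x # xs) \<le> ?m"
      using n by auto
    then show ?case ..
  qed simp
  then obtain n where "set xs \<subseteq> values_upto f n" "length xs \<le> n"
    by blast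
  then have "power_answer S \<UU> \<sigma> f (Suc n) \<subseteq> cube_root \<UU> (answer \<sigma> xs)"
    using assms(3) by auto
  then show ?thesis
    by (rule that)
qed

section \<open>Uniform convergence\<close>

lemma power_answer_uniform_limit:
  assumes comp: "compact_space X" and cu: "compatible_uniformity X \<UU>"
    and win: "winning_strategy X \<UU> \<sigma>"
    and f_mem: "\<And>n k. f n k \<in> topspace X"
    and f_step: "\<And>n k. (f n k, f (Suc n) k) \<in> power_answer (topspace X) \<UU> \<sigma> f n"
  obtains g where "\<And>k. g k \<in> topspace X"
    and "\<And>V. V \<in> \<UU> \<Longrightarrow> \<exists>N. \<forall>n\<ge>N. \<forall>k. (g k, f n k) \<in> V"
proof -
  have uni: "is_uniformity (topspace X) \<UU>"
    using cu unfolding compatible_uniformity_def by blast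
  note cr = cube_root[OF uni]
  define W where "W = power_answer (topspace X) \<UU> \<sigma> f"
  have W: "W n \<in> \<UU>" "sym (W n)" for n
    unfolding W_def using power_answer_in[OF uni] by blast+
  have W_Suc: "W (Suc n) \<subseteq> cube_root \<UU> (W n)" for n
    unfolding W_def by (rule power_answer_Suc_subset)
  have W_trans: "(x, z) \<in> W n" if "(x, y) \<in> W (Suc n)" "(y, z) \<in> W (Suc n)" for x y z n
    using cr(4)[OF W(1)] subsetD[OF W_Suc] that by blast
  have W_trans3: "(x, w) \<in> W n"
    if "(x, y) \<in> W (Suc n)" "(y, z) \<in> W (Suc n)" "(z, w) \<in> W (Suc n)" for x y z w n
    using cr(3)[OF W(1)] subsetD[OF W_Suc] that by blast
  \<comment> \<open>Two steps in \<open>W (Suc n)\<close> compose to one in \<open>W n\<close>, whence the index shifts below.\<close>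
  have f_close: "(f (Suc n) k, f (Suc n + d) k) \<in> W n" for n d k
  proof (induction d arbitrary: n)
    case 0
    then show ?case
      using is_uniformity_refl[OF uni W(1) f_mem] by simp
  next
    case (Suc d)
    have "(f (Suc n) k, f (Suc (Suc n)) k) \<in> W (Suc n)"
      using f_step unfolding W_def .
    moreover have "(f (Suc (Suc n)) k, f (Suc (Suc n) + d) k) \<in> W (Suc n)"
      by (rule Suc.IH)
    ultimately show ?case
      using W_trans by simp
  qed
  have "\<exists>y. y \<in> topspace X \<and> (\<forall>U\<in>\<UU>. infinite {j. (y, f j k) \<in> U})" for k
  proof -
    obtain y y' where y: "y \<in> topspace X" "y' \<in> topspace X"
      "\<forall>U\<in>\<UU>. infinite {j \<in> UNIV. (y, f j k) \<in> U \<and> (y', f j k) \<in> U}"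
      using compatible_uniformity_cluster_pair[where p = "\<lambda>j. f j k" and q = "\<lambda>j. f j k",
          OF comp cu infinite_UNIV_nat f_mem f_mem] by (elim bexE)
    have "infinite {j. (y, f j k) \<in> U}" if "U \<in> \<UU>" for U
      by (rule infinite_super[OF _ bspec[OF y(3) that]]) blast
    then show ?thesis
      using y(1) by blast
  qed
  then obtain g where g: "\<And>k. g k \<in> topspace X"
    and g_cluster: "\<And>k U. U \<in> \<UU> \<Longrightarrow> infinite {j. (g k, f j k) \<in> U}"
    by metis
  have g_near: "\<exists>j\<ge>n. (g k, f j k) \<in> U" if "U \<in> \<UU>" for k U n
    using g_cluster[OF that, of k] unfolding infinite_nat_iff_unbounded_le by auto
  have fg: "(f j k, g k) \<in> W n" if nj: "n + 2 \<le> j" for j k n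
  proof -
    obtain i where i: "j = Suc (Suc n) + i"
      using le_Suc_ex[OF nj] by auto
    obtain m where m: "m \<ge> j" "(g k, f m k) \<in> W (Suc n)"
      using g_near[OF W(1)] by blast
    obtain d where d: "m = Suc (Suc n + i) + d"
      using le_Suc_ex[OF m(1)] i by auto
    have "(f j k, f m k) \<in> W (Suc n + i)"
      using f_close[of "Suc n + i" k d] i d by simp
    moreover have "W (Suc n + i) \<subseteq> W (Suc n)"
      unfolding W_def by (rule power_answer_antimono[OF uni]) simp
    ultimately show ?thesis
      using W_trans[OF _ symD[OF W(2) m(2)]] by blast
  qed
  have "\<exists>N. \<forall>n\<ge>N. \<forall>k. (g k, f n k) \<in> V" if V: "V \<in> \<UU>" for V
  proof (rule ccontr)
    assume "\<not> ?thesis"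
    then have "\<forall>N. \<exists>n\<ge>N. n \<in> {n. \<exists>k. (g k, f n k) \<notin> V}"
      by blast
    then have inf: "infinite {n. \<exists>k. (g k, f n k) \<notin> V}" (is "infinite ?J")
      unfolding infinite_nat_iff_unbounded_le by blast
    have "\<forall>n\<in>?J. \<exists>k. (g k, f n k) \<notin> V"
      by blast
    from bchoice[OF this] obtain \<kappa> where \<kappa>: "\<forall>n\<in>?J. (g (\<kappa> n), f n (\<kappa> n)) \<notin> V"
      by (elim exE)
    obtain a b where ab: "a \<in> topspace X" "b \<in> topspace X"
      and inf_ab: "\<forall>U\<in>\<UU>. infinite {j \<in> ?J. (a, f j (\<kappa> j)) \<in> U \<and> (b, g (\<kappa> j)) \<in> U}"
      using compatible_uniformity_cluster_pair[where p = "\<lambda>j. f j (\<kappa> j)" and q = "\<lambda>j. g (\<kappa> j)",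
          OF comp cu inf f_mem g] by (elim bexE)
    have near: "\<exists>j\<ge>n. j \<in> ?J \<and> (a, f j (\<kappa> j)) \<in> U \<and> (b, g (\<kappa> j)) \<in> U" if "U \<in> \<UU>" for U n
      using bspec[OF inf_ab that] unfolding infinite_nat_iff_unbounded_le by auto
    let ?C = "range (\<lambda>(i, k). f i k)"
    \<comment> \<open>\<open>(a, b)\<close> is close to a pair \<open>(f j k, g k)\<close> with \<open>j\<close> large, which is itself in \<open>W\<close>.\<close>
    have ab_W: "(a, b) \<in> W n" for n
    proof -
      obtain j where j: "j \<ge> Suc n + 2" "(a, f j (\<kappa> j)) \<in> W (Suc n)" "(b, g (\<kappa> j)) \<in> W (Suc n)"
        using near[OF W(1)] by blast
      then show ?thesis
        using W_trans3 fg symD[OF W(2)] by blast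
    qed
    have "(a, b) \<in> cube_root \<UU> V"
    proof (rule answers_separate_closure[OF cu win, of ?C])
      show "?C \<subseteq> topspace X"
        using f_mem by auto
      show "\<exists>y\<in>?C. (a, y) \<in> U" if "U \<in> \<UU>" for U
        using near[OF that, of 0] by auto
      show "\<exists>y\<in>?C. (b, y) \<in> U" if U: "U \<in> \<UU>" for U
      proof -
        obtain j where j: "(b, g (\<kappa> j)) \<in> cube_root \<UU> U"
          using near[OF cr(1)[OF U], of 0] by blast
        obtain i where "(g (\<kappa> j), f i (\<kappa> j)) \<in> cube_root \<UU> U"
          using g_near[OF cr(1)[OF U]] by blast
        with j have "(b, f i (\<kappa> j)) \<in> U"
          using cr(4)[OF U] by blast
        then show ?thesis
          by auto
      qed
      show "(a, b) \<in> cube_root \<UU> (answer \<sigma> xs)" if "set xs \<subseteq> ?C" "answer \<sigma> xs \<in> \<UU>" for xs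
        using power_answer_refines_answers[OF uni that] ab_W unfolding W_def by blast
      show "cube_root \<UU> V \<in> \<UU>"
        using cr(1)[OF V] .
    qed (use ab in auto)
    moreover obtain j where "j \<in> ?J" "(a, f j (\<kappa> j)) \<in> cube_root \<UU> V"
      "(b, g (\<kappa> j)) \<in> cube_root \<UU> V"
      using near[OF cr(1)[OF V]] by blast
    ultimately show False
      using cr(3)[OF V] \<kappa> symD[OF cr(2)[OF V]] by blast
  qed
  then show ?thesis
    using that g by blast
qed

section \<open>The uniform power\<close>

lemma power_entourage_in:
  assumes "is_uniformity S \<UU>" "U \<in> \<UU>"
  shows "power_entourage U \<in> power_uniformity S \<UU>"
  using assms power_entourage_subset[OF is_uniformity_subset[OF assms]]
  by (intro power_uniformityI[of U]) simp_all

lemma topspace_uniform_power_wrt: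
  assumes "is_uniformity S \<UU>"
  shows "topspace (uniform_power_wrt S \<UU>) = UNIV \<rightarrow> S"
  unfolding uniform_power_wrt_def
  by (rule topspace_uniform_topology[OF is_uniformity_power[OF assms]])

lemma Hausdorff_uniform_power_wrt:
  assumes cu: "compatible_uniformity X \<UU>" and "Hausdorff_space X"
  shows "Hausdorff_space (uniform_power_wrt (topspace X) \<UU>)"
proof -
  have uni: "is_uniformity (topspace X) \<UU>" and X: "uniform_topology (topspace X) \<UU> = X"
    using cu unfolding compatible_uniformity_def by blast+
  let ?S = "topspace X" and ?P = "UNIV \<rightarrow> topspace X :: (nat \<Rightarrow> 'a) set"
  have open_cylinder: "openin (uniform_power_wrt ?S \<UU>) {h \<in> ?P. h n \<in> A}"
    if A: "openin X A" for A n
    unfolding uniform_power_wrt_def openin_uniform_topology[OF is_uniformity_power[OF uni]]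
  proof (intro conjI ballI)
    fix h assume h: "h \<in> {h \<in> ?P. h n \<in> A}"
    have "openin (uniform_topology ?S \<UU>) A"
      using A X by simp
    then obtain U where U: "U \<in> \<UU>" "U `` {h n} \<subseteq> A"
      using h unfolding openin_uniform_topology[OF uni] by blast
    have "power_entourage U `` {h} \<subseteq> {h \<in> ?P. h n \<in> A}"
      using U(2) power_entourage_subset[OF is_uniformity_subset[OF uni U(1)]]
      unfolding power_entourage_def by blast
    then show "\<exists>W\<in>power_uniformity ?S \<UU>. W `` {h} \<subseteq> {h \<in> ?P. h n \<in> A}"
      using power_entourage_in[OF uni U(1)] by blast
  qed blast
  show ?thesis
    unfolding Hausdorff_space_def topspace_uniform_power_wrt[OF uni]
  proof (intro allI impI)
    fix f g assume fg: "f \<in> ?P \<and> g \<in> ?P \<and> f \<noteq> g"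
    then obtain n where "f n \<noteq> g n"
      by blast
    moreover from fg have "f n \<in> ?S" "g n \<in> ?S"
      by auto
    ultimately obtain A B where "openin X A" "openin X B" "f n \<in> A" "g n \<in> B" "disjnt A B"
      using assms(2) unfolding Hausdorff_space_def by metis
    then show "\<exists>A B. openin (uniform_power_wrt ?S \<UU>) A \<and> openin (uniform_power_wrt ?S \<UU>) B
        \<and> f \<in> A \<and> g \<in> B \<and> disjnt A B"
      using fg
      by (intro exI[of _ "{h \<in> ?P. h n \<in> A}"] exI[of _ "{h \<in> ?P. h n \<in> B}"])
        (auto simp: open_cylinder disjnt_iff)
  qed
qed

lemma limitin_uniform_power_wrt:
  assumes uni: "is_uniformity S \<UU>" and "\<And>k. g k \<in> S"
    and "\<And>V. V \<in> \<UU> \<Longrightarrow> \<exists>N. \<forall>n\<ge>N. \<forall>k. (g k, f n k) \<in> V"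
  shows "limitin (uniform_power_wrt S \<UU>) f g sequentially"
  unfolding limitin_sequentially topspace_uniform_power_wrt[OF uni]
proof (intro conjI allI impI)
  show "g \<in> UNIV \<rightarrow> S"
    using assms(2) by simp
  fix A assume A: "openin (uniform_power_wrt S \<UU>) A \<and> g \<in> A"
  then obtain V where "V \<in> power_uniformity S \<UU>" "V `` {g} \<subseteq> A"
    unfolding uniform_power_wrt_def openin_uniform_topology[OF is_uniformity_power[OF uni]]
    by blast
  moreover from this obtain U where "U \<in> \<UU>" "power_entourage U \<subseteq> V"
    using power_uniformityE by metis
  moreover from this obtain N where "\<forall>n\<ge>N. \<forall>k. (g k, f n k) \<in> U"
    using assms(3) by blast
  ultimately show "\<exists>N. \<forall>n\<ge>N. f n \<in> A"
    unfolding power_entourage_def by blast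
qed

lemma winning_power_strategy:
  assumes comp: "compact_space X" and cu: "compatible_uniformity X \<UU>"
    and win: "winning_strategy X \<UU> \<sigma>"
  shows "winning_strategy (uniform_power_wrt (topspace X) \<UU>) (power_uniformity (topspace X) \<UU>)
    (power_strategy (topspace X) \<UU> \<sigma>)"
  unfolding winning_strategy_def
proof (intro allI impI conjI)
  let ?S = "topspace X"
  have uni: "is_uniformity ?S \<UU>"
    using cu unfolding compatible_uniformity_def by blast
  fix U f
  assume "\<forall>n. U n = power_strategy ?S \<UU> \<sigma> (history U f n)"
  then have U: "U n = power_entourage (power_answer ?S \<UU> \<sigma> f n)" for n
    using power_strategy_history by metis
  show "legal_move_1 (power_uniformity ?S \<UU>) U n" for n
  proof -
    have "U n \<in> power_uniformity ?S \<UU>"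
      unfolding U using power_answer_in[OF uni] power_entourage_in[OF uni] by blast
    moreover have "sym (U n)"
      using power_answer_in[OF uni, of \<sigma> f n] unfolding U sym_def power_entourage_def by blast
    moreover have "U (Suc m) \<subseteq> U m" for m
      using subsetD[OF power_answer_antimono[OF uni, of m "Suc m" \<sigma> f]]
      unfolding U power_entourage_def by (auto simp del: power_answer.simps)
    ultimately show ?thesis
      unfolding legal_move_1_def by (simp split: nat.split)
  qed
  assume "\<forall>n. legal_move_2 (topspace (uniform_power_wrt ?S \<UU>)) U f n"
  then have legal: "legal_move_2 (UNIV \<rightarrow> ?S) U f n" for n
    unfolding topspace_uniform_power_wrt[OF uni] by blast
  have step: "(f n k, f (Suc n) k) \<in> power_answer ?S \<UU> \<sigma> f n" for n k
    using legal[of "Suc n"] unfolding legal_move_2_def U power_entourage_def by auto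
  have "f n k \<in> ?S" for n k
  proof (cases n)
    case 0
    then show ?thesis
      using legal[of 0] unfolding legal_move_2_def by auto
  next
    case (Suc m)
    have "power_answer ?S \<UU> \<sigma> f m \<subseteq> ?S \<times> ?S"
      using is_uniformity_subset[OF uni] power_answer_in[OF uni] by blast
    then show ?thesis
      using step[of m k] Suc by blast
  qed
  then obtain g where "\<And>k. g k \<in> ?S" "\<And>V. V \<in> \<UU> \<Longrightarrow> \<exists>N. \<forall>n\<ge>N. \<forall>k. (g k, f n k) \<in> V"
    using power_answer_uniform_limit[OF comp cu win _ step] by metis
  then show "player_1_wins (uniform_power_wrt ?S \<UU>) U f"
    unfolding player_1_wins_def using limitin_uniform_power_wrt[OF uni] by blast
qed

theorem theorem1p2:
  fixes X :: "'a topology"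
  assumes "compact_space X" and "Hausdorff_space X"
    and "proximal X"
  shows "proximal (uniform_power X)"
proof -
  obtain \<UU> \<sigma> where cu: "compatible_uniformity X \<UU>" and win: "winning_strategy X \<UU> \<sigma>"
    using assms(3) unfolding proximal_def by blast
  have uni: "is_uniformity (topspace X) \<UU>"
    using cu unfolding compatible_uniformity_def by blast
  show ?thesis
    unfolding proximal_def uniform_power_eq[OF assms(1) cu]
    using Hausdorff_uniform_power_wrt[OF cu assms(2)] compatible_uniformity_power[OF uni]
      winning_power_strategy[OF assms(1) cu win] by blast
qed

end
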